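(* In the risk model with interest rate described in the context (including its standing assumptions on the process $Y$), for a real number $l>0$ put $$L(Y(l)):=\sup\{h\ge 0:\ \mathbf{E}e^{hY(l)}\le 1\}.$$ Suppose there exists a real number $l>0$ such that for each $h\in[0,L(Y(l))]$ and any $t\ge 0$ $$e^{r(t+l)}\big[\mathbf{E}e^{he^{-r(t+l)}Z(t+l)}-1\big]\le e^{r(t)}\big[\mathbf{E}e^{he^{-r(t)}Z(t)}-1\big],$$ and such that for any $t\ge 0$ $$e^{-r(t+l)}\Lambda'(t+l)\le e^{-r(t)}\Lambda'(t)\quad\text{and}\quad e^{-r(t+l)}p'(t+l)\ge e^{-r(t)}p'(t).$$ Then for each $h\in[0,L(Y(l))]$ $$\sup_{t\ge 0}\mathbf{E}e^{hY(t)}=\sup_{0\le t\le l}\mathbf{E}e^{hY(t)},$$ and for any $u>0$ and $T\ge 0$, $$\psi(u,T)\le\mathbf{P}\Big(\sup_{0\le t\le T}Y(t)>u\Big)\le e^{-hu}\sup_{0\le t\le T}\mathbf{E}e^{hY(t)},\qquad \psi(u)\le\mathbf{P}\Big(\sup_{t\ge 0}Y(t)>u\Big)\le e^{-hu}\sup_{0\le t\le l}\mathbf{E}e^{hY(t)}.$$ In addition, for any $u>0$, $$\psi(u)\le\inf_{h\in[0,L(Y(l))]}\Big\{e^{-hu}\sup_{0\le t\le l}\mathbf{E}e^{hY(t)}\Big\}\le C_2e^{-L(Y(l))u},\qquad C_2:=\sup_{0\le t\le l}\mathbf{E}e^{L(Y(l))Y(t)}.$$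
   Context: Model B: $N(t)$, $t\ge 0$, is a non-homogeneous Poisson process with non-decreasing accumulated intensity function $\Lambda(t)=\mathbf{E}N(t)<\infty$, $N(0)=\Lambda(0)=0$, with claim times $T_j=\min\{t\ge 0:N(t)\ge j\}$. $Z(t)\ge 0$ denotes the claim size in case a claim arrives at time $t$; $N(\cdot)$ and $Z(\cdot)$ are independent, and the $Z(T_j)$, $j\ge1$, are independent but not necessarily identically distributed. $p(t)\ge 0$ is the non-decreasing aggregate premium income over $[0,t]$, and $q(t)$ is the total claim amount over $[0,t]$ (the principal case being $q(t)=\sum_{j=1}^{N(t)}Z(T_j)$). The risk reserve process $R$, with $R(0)=u>0$, satisfies for all $t_2>t_1\ge 0$ $$R(t_2)=(1+\alpha(t_1,t_2))R(t_1)+(1+\beta(t_1,t_2))[p(t_2)-p(t_1)]-[q(t_2)-q(t_1)],$$ where $\beta(t_1,t_2)\ge 0$ and $1+\alpha(t_1,t_2)\ge e^{r(t_2)-r(t_1)}$ for a non-random non-decreasing function $r$ with $r(0)=0$. Put $S(t)=q(t)-p(t)$, assumed of bounded variation on finite intervals, and $Y(t)=\int_0^te^{-r(x)}\,dS(x)$, so $Y(0)=0$. The ruin probabilities are $\psi(u)=\mathbf{P}(\inf_{t\ge 0}R(t)<0)$ and $\psi(u,T)=\mathbf{P}(\inf_{0\le t\le T}R(t)<0)$. Standing assumptions: (i) $e^{-r(t)}R(t)\ge u-Y(t)$ for all $t>0$; (ii) $Y$ is a separable process (in Doob's sense) with independent increments; (iii) $\Lambda$ has a density $\Lambda'\ge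 0$ and $p$ has a density $p'\ge0$, and for all $h\ge0$, $t>0$, $$\mathbf{E}e^{hY(t)}=\exp\Big\{-\int_0^the^{-r(x)}p'(x)\,dx+\int_0^t\big(\mathbf{E}e^{he^{-r(x)}Z(x)}-1\big)\Lambda'(x)\,dx\Big\}.$$ Exponential moments may equal $+\infty$. If $L(Y(l))=\infty$, the interval $[0,L(Y(l))]$ is read as $[0,\infty)$ and the last inequality (the one with $C_2$) is not asserted. *)

theory Defs
  imports "HOL-Probability.Probability"
begin

(* Pathwise integral of f dS over [a,b] as a gauge (Kurzweil-)Stieltjes integral.  It is unique
   when it exists; it agrees with the Riemann-Stieltjes integral whenever that one exists, and
   with the Lebesgue-Stieltjes integral over (a,b] for right-continuous S of bounded variation.
   Unlike Riemann-Stieltjes, it tolerates common jumps of f and S. *)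
definition has_stieltjes_integral ::
    "(real \<Rightarrow> real) \<Rightarrow> (real \<Rightarrow> real) \<Rightarrow> real \<Rightarrow> real \<Rightarrow> real \<Rightarrow> bool" where
  "has_stieltjes_integral f S a b I \<longleftrightarrow>
     (\<forall>e>0. \<exists>\<gamma>. gauge \<gamma> \<and>
        (\<forall>D. D tagged_division_of {a..b} \<and> \<gamma> fine D \<longrightarrow>
             \<bar>(\<Sum>(x, K)\<in>D. f x * (S (Sup K) - S (Inf K))) - I\<bar> < e))"

definition bounded_variation_on :: "(real \<Rightarrow> real) \<Rightarrow> real \<Rightarrow> real \<Rightarrow> bool" where
  "bounded_variation_on S a b \<longleftrightarrow>
     (\<exists>B. \<forall>D. D division_of {a..b} \<longrightarrow> (\<Sum>K\<in>D. \<bar>S (Sup K) - S (Inf K)\<bar>) \<le> B)"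

definition indep_increments :: "'a measure \<Rightarrow> (real \<Rightarrow> 'a \<Rightarrow> real) \<Rightarrow> bool" where
  "indep_increments M X \<longleftrightarrow>
     (\<forall>n (\<tau> :: nat \<Rightarrow> real). 0 \<le> \<tau> 0 \<and> (\<forall>i<n. \<tau> i < \<tau> (Suc i)) \<longrightarrow>
        prob_space.indep_vars M (\<lambda>_. borel) (\<lambda>i \<omega>. X (\<tau> (Suc i)) \<omega> - X (\<tau> i) \<omega>) {..<n})"

(* Doob's separability (relative to the class of closed intervals, bounded or not) of a process
   with parameter set [0, \<infinity>); J ranges over open intervals, A over closed ones. *)
definition separable_process :: "'a measure \<Rightarrow> (real \<Rightarrow> 'a \<Rightarrow> real) \<Rightarrow> bool" where
  "separable_process M X \<longleftrightarrow>
     (\<exists>D. countable D \<and> D \<subseteq> {0..} \<and>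
        (AE \<omega> in M. \<forall>J A. open J \<and> is_interval J \<and> closed A \<and> is_interval A \<longrightarrow>
           (\<forall>t\<in>J \<inter> D. X t \<omega> \<in> A) \<longrightarrow> (\<forall>t\<in>J \<inter> {0..}. X t \<omega> \<in> A)))"

definition exp_moment :: "'a measure \<Rightarrow> real \<Rightarrow> ('a \<Rightarrow> real) \<Rightarrow> ennreal" where
  "exp_moment M h X = (\<integral>\<^sup>+ \<omega>. ennreal (exp (h * X \<omega>)) \<partial>M)"

definition exp_ennreal :: "ennreal \<Rightarrow> ennreal" where
  "exp_ennreal x = (if x = \<infinity> then \<infinity> else ennreal (exp (enn2real x)))"

definition nonhom_poisson_process ::
    "'a measure \<Rightarrow> (real \<Rightarrow> 'a \<Rightarrow> nat) \<Rightarrow> (real \<Rightarrow> real) \<Rightarrow> bool" where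
  "nonhom_poisson_process M N \<Lambda> \<longleftrightarrow>
     (\<forall>t\<ge>0. N t \<in> measurable M (count_space UNIV)) \<and>
     (\<forall>\<omega>\<in>space M. N 0 \<omega> = 0 \<and> mono_on {0..} (\<lambda>t. N t \<omega>) \<and>
        (\<forall>t\<ge>0. continuous (at_right t) (\<lambda>s. N s \<omega>))) \<and>
     indep_increments M (\<lambda>t \<omega>. real (N t \<omega>)) \<and>
     (\<forall>s t k. 0 \<le> s \<and> s \<le> t \<longrightarrow>
        measure M {\<omega> \<in> space M. N t \<omega> - N s \<omega> = k} =
          (\<Lambda> t - \<Lambda> s) ^ k / fact k * exp (- (\<Lambda> t - \<Lambda> s))) \<and>
     (\<forall>t\<ge>0. integrable M (\<lambda>\<omega>. real (N t \<omega>)) \<and>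
        \<Lambda> t = integral\<^sup>L M (\<lambda>\<omega>. real (N t \<omega>)))"

definition claim_occurs :: "(real \<Rightarrow> 'a \<Rightarrow> nat) \<Rightarrow> nat \<Rightarrow> 'a \<Rightarrow> bool" where
  "claim_occurs N j \<omega> \<longleftrightarrow> (\<exists>t\<ge>0. j \<le> N t \<omega>)"

(* For right-continuous N the infimum is a minimum whenever the j-th claim occurs. *)
definition claim_time :: "(real \<Rightarrow> 'a \<Rightarrow> nat) \<Rightarrow> nat \<Rightarrow> 'a \<Rightarrow> real" where
  "claim_time N j \<omega> = Inf {t. 0 \<le> t \<and> j \<le> N t \<omega>}"

definition claim_size ::
    "(real \<Rightarrow> 'a \<Rightarrow> nat) \<Rightarrow> (real \<Rightarrow> 'a \<Rightarrow> real) \<Rightarrow> nat \<Rightarrow> 'a \<Rightarrow> real" where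
  "claim_size N Z j \<omega> = (if claim_occurs N j \<omega> then Z (claim_time N j \<omega>) \<omega> else 0)"

(* R, \<alpha> and \<beta> carry the initial capital u as their first argument.
   N - claims, Z - claim sizes, p - premiums, q - total claim amount, r - bound on the log-return. *)
locale risk_model = prob_space M
  for M :: "'a measure"
    and N :: "real \<Rightarrow> 'a \<Rightarrow> nat" and \<Lambda> \<Lambda>' :: "real \<Rightarrow> real"
    and Z :: "real \<Rightarrow> 'a \<Rightarrow> real"
    and p p' :: "real \<Rightarrow> real" and q :: "real \<Rightarrow> 'a \<Rightarrow> real"
    and r :: "real \<Rightarrow> real"
    and \<alpha> \<beta> :: "real \<Rightarrow> real \<Rightarrow> real \<Rightarrow> 'a \<Rightarrow> real"
    and R :: "real \<Rightarrow> real \<Rightarrow> 'a \<Rightarrow> real"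
    and Y :: "real \<Rightarrow> 'a \<Rightarrow> real" +
  assumes \<Lambda>_mono: "mono_on {0..} \<Lambda>" and \<Lambda>_0: "\<Lambda> 0 = 0"
    and \<Lambda>'_nonneg: "\<And>t. 0 \<le> t \<Longrightarrow> 0 \<le> \<Lambda>' t"
    and \<Lambda>_density: "\<And>t. 0 \<le> t \<Longrightarrow>
          set_integrable lborel {0..t} \<Lambda>' \<and> \<Lambda> t = (LBINT x:{0..t}. \<Lambda>' x)"
    and N_poisson: "nonhom_poisson_process M N \<Lambda>"
    and Z_rv: "\<And>t. 0 \<le> t \<Longrightarrow> random_variable borel (Z t)"
    and Z_nonneg: "AE \<omega> in M. \<forall>t\<ge>0. 0 \<le> Z t \<omega>"
    and N_Z_indep: "indep_var
          (PiM {0..} (\<lambda>_. borel)) (\<lambda>\<omega>. \<lambda>t\<in>{0..}. real (N t \<omega>))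
          (PiM {0..} (\<lambda>_. borel)) (\<lambda>\<omega>. \<lambda>t\<in>{0..}. Z t \<omega>)"
    \<comment> \<open>The first n claim sizes are only defined if the n-th claim occurs, so independence is
        taken conditionally on that event; if all claims occur almost surely, this is plain
        independence of the whole sequence.\<close>
    and claim_sizes_indep: "\<And>n. 0 < prob {\<omega> \<in> space M. claim_occurs N n \<omega>} \<Longrightarrow>
          prob_space.indep_vars (uniform_measure M {\<omega> \<in> space M. claim_occurs N n \<omega>})
            (\<lambda>_. borel) (claim_size N Z) {1..n}"
    and p_nonneg: "\<And>t. 0 \<le> t \<Longrightarrow> 0 \<le> p t" and p_mono: "mono_on {0..} p"
    and p'_nonneg: "\<And>t. 0 \<le> t \<Longrightarrow> 0 \<le> p' t"
    and p_density: "\<And>t. 0 \<le> t \<Longrightarrow>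
          set_integrable lborel {0..t} p' \<and> p t = (LBINT x:{0..t}. p' x)"
    and q_rv: "\<And>t. 0 \<le> t \<Longrightarrow> random_variable borel (q t)"
    and S_bounded_variation:
      "AE \<omega> in M. \<forall>t\<ge>0. bounded_variation_on (\<lambda>x. q x \<omega> - p x) 0 t"
    and r_mono: "mono_on {0..} r" and r_0: "r 0 = 0"
    and rates_rv: "\<And>u t1 t2. \<lbrakk>0 < u; 0 \<le> t1; t1 < t2\<rbrakk> \<Longrightarrow>
          random_variable borel (\<alpha> u t1 t2) \<and> random_variable borel (\<beta> u t1 t2)"
    and rates_bounds: "\<And>u. 0 < u \<Longrightarrow> AE \<omega> in M. \<forall>t1 t2. 0 \<le> t1 \<and> t1 < t2 \<longrightarrow>
          0 \<le> \<beta> u t1 t2 \<omega> \<and> exp (r t2 - r t1) \<le> 1 + \<alpha> u t1 t2 \<omega>"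
    and R_rv: "\<And>u t. \<lbrakk>0 < u; 0 \<le> t\<rbrakk> \<Longrightarrow> random_variable borel (R u t)"
    and R_0: "\<And>u. 0 < u \<Longrightarrow> AE \<omega> in M. R u 0 \<omega> = u"
    and R_eq: "\<And>u. 0 < u \<Longrightarrow> AE \<omega> in M. \<forall>t1 t2. 0 \<le> t1 \<and> t1 < t2 \<longrightarrow>
          R u t2 \<omega> = (1 + \<alpha> u t1 t2 \<omega>) * R u t1 \<omega>
            + (1 + \<beta> u t1 t2 \<omega>) * (p t2 - p t1) - (q t2 \<omega> - q t1 \<omega>)"
    and Y_rv: "\<And>t. 0 \<le> t \<Longrightarrow> random_variable borel (Y t)"
    and Y_integral: "AE \<omega> in M. \<forall>t\<ge>0.
          has_stieltjes_integral (\<lambda>x. exp (- r x)) (\<lambda>x. q x \<omega> - p x) 0 t (Y t \<omega>)"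
    and R_ge: "\<And>u. 0 < u \<Longrightarrow> AE \<omega> in M. \<forall>t>0. u - Y t \<omega> \<le> exp (- r t) * R u t \<omega>"
    and Y_separable: "separable_process M Y"
    and Y_indep_increments: "indep_increments M Y"
    \<comment> \<open>needed for the second integral in the moment formula to make sense\<close>
    and intensity_measurable: "\<And>h. 0 \<le> h \<Longrightarrow>
          (\<lambda>x. (exp_moment M (h * exp (- r x)) (Z x) - 1) * ennreal (\<Lambda>' x))
            \<in> borel_measurable (restrict_space lborel {0..})"
    and Y_exp_moment: "\<And>h t. \<lbrakk>0 \<le> h; 0 < t\<rbrakk> \<Longrightarrow>
          exp_moment M h (Y t) =
            ennreal (exp (- (LBINT x:{0..t}. h * exp (- r x) * p' x))) *
            exp_ennreal (\<integral>\<^sup>+ x\<in>{0..t}.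
              ((exp_moment M (h * exp (- r x)) (Z x) - 1) * ennreal (\<Lambda>' x)) \<partial>lborel)"

definition L_index :: "'a measure \<Rightarrow> ('a \<Rightarrow> real) \<Rightarrow> ennreal" where
  "L_index M X = (SUP h\<in>{h. 0 \<le> h \<and> exp_moment M h X \<le> 1}. ennreal h)"

(* Probability of an event given by a predicate.  On every event that is measurable up to null
   sets the outer measure is the (completed) probability, which covers {sup Y > u} for a separable
   Y; for a ruin event whose measurability is not guaranteed it avoids the value 0 that
   emeasure assigns to non-measurable sets. *)
definition Pr :: "'a measure \<Rightarrow> ('a \<Rightarrow> bool) \<Rightarrow> ennreal" where
  "Pr M P = outer_measure_of M {\<omega> \<in> space M. P \<omega>}"

definition ruin_prob :: "'a measure \<Rightarrow> (real \<Rightarrow> real \<Rightarrow> 'a \<Rightarrow> real) \<Rightarrow> real \<Rightarrow> ennreal" where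
  "ruin_prob M R u = Pr M (\<lambda>\<omega>. (INF t\<in>{0..}. ereal (R u t \<omega>)) < 0)"

definition ruin_prob_finite ::
    "'a measure \<Rightarrow> (real \<Rightarrow> real \<Rightarrow> 'a \<Rightarrow> real) \<Rightarrow> real \<Rightarrow> real \<Rightarrow> ennreal" where
  "ruin_prob_finite M R u T = Pr M (\<lambda>\<omega>. (INF t\<in>{0..T}. ereal (R u t \<omega>)) < 0)"

end

theory Submission
  imports Defs
begin

text \<open>For \<open>h \<le> L\<close> one has \<open>E exp (h Y(l)) \<le> 1\<close>, by convexity of \<open>exp\<close> below \<open>L\<close> and by Fatou's lemma
  at \<open>L\<close>. The shift hypotheses make the log-moment subadditive, so
  \<open>E exp (h Y(t + l)) \<le> E exp (h Y(l)) * E exp (h Y(t)) \<le> E exp (h Y(t))\<close> and the supremum over all times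
  already equals the one over \<open>[0, l]\<close>. The maximal inequality is Doob's for the martingale
  \<open>exp (h Y(t)) / E exp (h Y(t))\<close>, first along finitely many times and then, by separability, for all times.
  Ruin forces \<open>Y(t) > u\<close> for some \<open>t > 0\<close>.\<close>

section \<open>Outer probability, independent products and exponential moments\<close>

text \<open>The events may fail to be measurable. A measurable cover of the \<open>Q\<close> event
  with the same outer measure, enlarged by the exceptional null set, also covers the
  \<open>P\<close> event at no extra cost.\<close>

lemma Pr_mono_AE:
  assumes "AE \<omega> in M. P \<omega> \<longrightarrow> Q \<omega>"
  shows "Pr M P \<le> Pr M Q"
proof -
  from assms obtain A where A: "A \<in> null_sets M" "{\<omega> \<in> space M. \<not> (P \<omega> \<longrightarrow> Q \<omega>)} \<subseteq> A"
    by (auto simp: eventually_ae_filter)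
  obtain E where E: "E \<in> sets M" "{\<omega> \<in> space M. Q \<omega>} \<subseteq> E" "Pr M Q = emeasure M E"
    unfolding Pr_def using outer_measure_of_attain[of "{\<omega> \<in> space M. Q \<omega>}" M] by auto
  have "Pr M P \<le> outer_measure_of M (E \<union> A)"
    unfolding Pr_def using A E by (intro outer_measure_of_mono) auto
  also have "\<dots> = emeasure M E"
    using A E by (subst outer_measure_of_eq) (auto simp: emeasure_Un_null_set)
  finally show ?thesis using E by simp
qed

lemma (in prob_space) indep_var_nn_integral_mult:
  fixes f g :: "'a \<Rightarrow> ennreal"
  assumes "indep_var borel f borel g"
  shows "(\<integral>\<^sup>+\<omega>. f \<omega> * g \<omega> \<partial>M) = (\<integral>\<^sup>+\<omega>. f \<omega> \<partial>M) * (\<integral>\<^sup>+\<omega>. g \<omega> \<partial>M)"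
proof -
  have "(\<lambda>b. case_bool borel borel b) = (\<lambda>_. borel :: ennreal measure)"
    by (auto split: bool.split)
  then have "indep_vars (\<lambda>_. borel) (case_bool f g) UNIV"
    using assms by (simp add: indep_var_def)
  from indep_vars_nn_integral[OF _ this] show ?thesis
    by (simp add: UNIV_bool mult.commute)
qed

text \<open>A strictly positive integrand cannot integrate to zero over a probability space. This
  permits cancelling a moment at the end of the maximal inequality.\<close>

lemma exp_moment_pos:
  assumes "prob_space M" "X \<in> borel_measurable M"
  shows "exp_moment M h X \<noteq> 0"
proof
  interpret prob_space M by fact
  assume "exp_moment M h X = 0"
  then have "AE \<omega> in M. ennreal (exp (h * X \<omega>)) = 0"
    unfolding exp_moment_def using assms(2) by (subst (asm) nn_integral_0_iff_AE) auto
  then have "AE \<omega> in M. False" by eventually_elim (simp add: ennreal_eq_0_iff not_le)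
  then show False by simp
qed

lemma exp_moment_cong_AE:
  "AE \<omega> in M. X \<omega> = X' \<omega> \<Longrightarrow> exp_moment M h X = exp_moment M h X'"
  unfolding exp_moment_def by (rule nn_integral_cong_AE) auto

lemma (in prob_space) exp_moment_0 [simp]: "exp_moment M 0 X = 1"
  by (simp add: exp_moment_def emeasure_space_1)

section \<open>Exponential maximal inequality for independent increments\<close>

text \<open>With \<^term>\<open>W\<close> the partial sums and \<open>m k\<close> the exponential moment of \<open>W k\<close>, the quotient
  \<open>exp (h * W k) / m k\<close> is a martingale, even though \<open>exp (h * W k)\<close> need not be a sub- or
  supermartingale; the induction is Doob's inequality for it, cleared of denominators.\<close>

lemma (in prob_space) exp_maximal_inequality_indep_sums:
  fixes X :: "nat \<Rightarrow> 'a \<Rightarrow> real" and s :: ennreal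
  assumes indep: "indep_vars (\<lambda>_. borel) X {..<n}" and h: "0 \<le> h"
    and s: "\<And>k. k \<le> n \<Longrightarrow> exp_moment M h (\<lambda>\<omega>. \<Sum>i<k. X i \<omega>) \<le> s"
  shows "emeasure M {\<omega> \<in> space M. \<exists>k\<le>n. u < (\<Sum>i<k. X i \<omega>)} \<le> ennreal (exp (- h * u)) * s"
\<comment> \<open>The closing cancellation needs finite moments. If \<open>s\<close> is infinite, so
  is the right-hand side, because its exponential factor is not zero.\<close>
proof (cases "s = \<infinity>")
  case True
  then show ?thesis by (simp add: ennreal_mult_top)
next
  case False
  define W where "W k \<omega> = (\<Sum>i<k. X i \<omega>)" for k \<omega>
  define m where "m k = exp_moment M h (W k)" for k
  define B where "B k = {\<omega> \<in> space M. \<exists>j\<le>k. u < W j \<omega>}" for k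
  define g where "g k \<omega> = ennreal (exp (h * W k \<omega>))" for k \<omega>
  have X_rv: "X i \<in> borel_measurable M" if "i < n" for i
    using indep that by (auto simp: indep_vars_def)
  have W_rv [measurable]: "W k \<in> borel_measurable M" if "k \<le> n" for k
    unfolding W_def using that by (intro borel_measurable_sum X_rv) auto
  have g_rv [measurable]: "g k \<in> borel_measurable M" if "k \<le> n" for k
    unfolding g_def using W_rv[OF that] by measurable
  have B_sets: "B k \<in> sets M" if "k \<le> n" for k
  proof -
    have "B k = (\<Union>j\<le>k. {\<omega> \<in> space M. u < W j \<omega>})" by (auto simp: B_def)
    also have "\<dots> \<in> sets M"
    proof (rule sets.finite_UN)
      fix j assume "j \<in> {..k}"
      then have [measurable]: "W j \<in> borel_measurable M" using that by (intro W_rv) auto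
      show "{\<omega> \<in> space M. u < W j \<omega>} \<in> sets M" by measurable
    qed simp
    finally show ?thesis .
  qed
  have m_eq: "m k = (\<integral>\<^sup>+\<omega>. g k \<omega> \<partial>M)" for k
    by (simp add: m_def exp_moment_def g_def)
  have m_le: "m k \<le> s" if "k \<le> n" for k
    using s[OF that] by (simp add: m_def W_def[abs_def])
  \<comment> \<open>\<open>X k\<close> is independent of the earlier summands, so its exponential
    factors out of any nonnegative functional \<open>G\<close> of them. This is applied to
    \<open>m\<close> and to the paths that have not yet exceeded \<open>u\<close>.\<close>
  have step: "(\<integral>\<^sup>+\<omega>. G (\<lambda>i\<in>{..<k}. X i \<omega>) * ennreal (exp (h * X k \<omega>)) \<partial>M)
      = (\<integral>\<^sup>+\<omega>. G (\<lambda>i\<in>{..<k}. X i \<omega>) \<partial>M) * exp_moment M h (X k)"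
    if k: "k < n" and G: "G \<in> borel_measurable (PiM {..<k} (\<lambda>_. borel))" for G k
  proof -
    have "indep_vars (\<lambda>_. borel) X (insert k {..<k})"
      by (rule indep_vars_subset[OF indep]) (use k in auto)
    then have "indep_var (PiM {..<k} (\<lambda>_. borel)) (\<lambda>\<omega>. restrict (\<lambda>i. X i \<omega>) {..<k})
        (PiM {k} (\<lambda>_. borel)) (\<lambda>\<omega>. restrict (\<lambda>i. X i \<omega>) {k})"
      by (rule indep_var_restrict) auto
    then have "indep_var borel (G \<circ> (\<lambda>\<omega>. restrict (\<lambda>i. X i \<omega>) {..<k}))
        borel ((\<lambda>f. ennreal (exp (h * f k))) \<circ> (\<lambda>\<omega>. restrict (\<lambda>i. X i \<omega>) {k}))"
      by (rule indep_var_compose) (use G in auto)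
    from indep_var_nn_integral_mult[OF this] show ?thesis
      by (simp add: exp_moment_def)
  qed
  have g_Suc: "g (Suc k) \<omega> = g k \<omega> * ennreal (exp (h * X k \<omega>))" for k \<omega>
    by (simp add: g_def W_def distrib_left exp_add ennreal_mult)
  have m_Suc: "m (Suc k) = m k * exp_moment M h (X k)" if k: "k < n" for k
  proof -
    have *: "g k \<omega> = ennreal (exp (h * sum (\<lambda>i\<in>{..<k}. X i \<omega>) {..<k}))" for \<omega>
      by (simp add: g_def W_def)
    show ?thesis
      unfolding m_eq g_Suc *
      by (rule step[of k "\<lambda>f. ennreal (exp (h * sum f {..<k}))", OF k]) simp
  qed
  \<comment> \<open>Staying at or below \<open>u\<close> up to step \<open>k\<close> depends on the
    first \<open>k\<close> summands only, so the surviving mass is multiplied by the same factor as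
    \<open>m\<close>: the martingale property in the form required.\<close>
  have safe_Suc: "(\<integral>\<^sup>+\<omega>. g (Suc k) \<omega> * indicator (space M - B k) \<omega> \<partial>M)
      = (\<integral>\<^sup>+\<omega>. g k \<omega> * indicator (space M - B k) \<omega> \<partial>M) * exp_moment M h (X k)"
    if k: "k < n" for k
  proof -
    let ?G = "\<lambda>f. ennreal (exp (h * sum f {..<k})) *
      (if \<exists>j\<in>{..k}. u < sum f {..<j} then 0 else 1)"
    have proj: "(\<lambda>f. sum f {..<j}) \<in> borel_measurable (PiM {..<k} (\<lambda>_. borel :: real measure))"
      if "j \<le> k" for j
      using that by (intro borel_measurable_sum measurable_component_singleton) auto
    have "Measurable.pred (PiM {..<k} (\<lambda>_. borel :: real measure)) (\<lambda>f. u < sum f {..<j})"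
      if "j \<le> k" for j
      using proj[OF that] by measurable
    then have "Measurable.pred (PiM {..<k} (\<lambda>_. borel :: real measure))
        (\<lambda>f. \<exists>j\<in>{..k}. u < sum f {..<j})"
      by (intro pred_intros_finite) auto
    then have G: "?G \<in> borel_measurable (PiM {..<k} (\<lambda>_. borel))"
      using proj[OF order_refl] by measurable
    have *: "g k \<omega> * indicator (space M - B k) \<omega> = ?G (\<lambda>i\<in>{..<k}. X i \<omega>)"
      if "\<omega> \<in> space M" for \<omega>
    proof -
      have "sum (\<lambda>i\<in>{..<k}. X i \<omega>) {..<j} = W j \<omega>" if "j \<le> k" for j
        unfolding W_def using that by (intro sum.cong) auto
      then show ?thesis
        using that by (auto simp: g_def B_def indicator_def)
    qed
    have "(\<integral>\<^sup>+\<omega>. g (Suc k) \<omega> * indicator (space M - B k) \<omega> \<partial>M)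
        = (\<integral>\<^sup>+\<omega>. ?G (\<lambda>i\<in>{..<k}. X i \<omega>) * ennreal (exp (h * X k \<omega>)) \<partial>M)"
      by (intro nn_integral_cong) (simp only: *[symmetric] g_Suc ac_simps)
    also have "\<dots> = (\<integral>\<^sup>+\<omega>. ?G (\<lambda>i\<in>{..<k}. X i \<omega>) \<partial>M) * exp_moment M h (X k)"
      by (rule step[of k ?G, OF k G])
    also have "(\<integral>\<^sup>+\<omega>. ?G (\<lambda>i\<in>{..<k}. X i \<omega>) \<partial>M)
        = (\<integral>\<^sup>+\<omega>. g k \<omega> * indicator (space M - B k) \<omega> \<partial>M)"
      by (intro nn_integral_cong) (simp only: *)
    finally show ?thesis .
  qed
  \<comment> \<open>Markov's inequality on a set of paths above level \<open>u\<close>, where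
    \<open>g k\<close> is at least \<open>exp (h * u)\<close> because
    \<open>0 \<le> h\<close>.\<close>
  have exit: "ennreal (exp (h * u)) * emeasure M A \<le> (\<integral>\<^sup>+\<omega>. g k \<omega> * indicator A \<omega> \<partial>M)"
    if "A \<in> sets M" "\<And>\<omega>. \<omega> \<in> A \<Longrightarrow> u < W k \<omega>" for A k
  proof -
    have "ennreal (exp (h * u)) * emeasure M A
        = (\<integral>\<^sup>+\<omega>. ennreal (exp (h * u)) * indicator A \<omega> \<partial>M)"
      using that by (simp add: nn_integral_cmult_indicator)
    also have "\<dots> \<le> (\<integral>\<^sup>+\<omega>. g k \<omega> * indicator A \<omega> \<partial>M)"
      using h
      by (intro nn_integral_mono)
        (auto simp: g_def indicator_def intro!: ennreal_leI mult_left_mono less_imp_le[OF that(2)])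
    finally show ?thesis .
  qed
  define c where "c k = ennreal (exp (h * u)) * emeasure M (B k)" for k
  define I where "I k A = (\<integral>\<^sup>+\<omega>. g k \<omega> * indicator A \<omega> \<partial>M)" for k A
  have I_split: "I k (A \<union> A') = I k A + I k A'"
    if "k \<le> n" "A \<in> sets M" "A' \<in> sets M" "A \<inter> A' = {}" for k A A'
    unfolding I_def using that g_rv[OF that(1)]
    by (subst nn_integral_add[symmetric])
      (auto simp: indicator_def intro!: nn_integral_cong)
  \<comment> \<open>Divided by \<open>m k\<close>, the invariant bounds \<open>c k\<close> plus
    \<open>s\<close> times the mass of the martingale on the surviving paths by \<open>s\<close>.
    Keeping the survivors on the left makes the induction close.\<close>
  have main: "c k * m k + s * I k (space M - B k) \<le> s * m k" if "k \<le> n" for k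
    using that
  proof (induction k)
    case 0
    have "c 0 \<le> I 0 (B 0)"
      unfolding c_def I_def using B_sets[of 0] by (intro exit) (auto simp: B_def)
    moreover have "m 0 \<le> s" by (simp add: m_le)
    ultimately have "c 0 * m 0 + s * I 0 (space M - B 0) \<le> s * (I 0 (B 0) + I 0 (space M - B 0))"
      by (auto simp: distrib_left mult.commute[of s] intro!: add_mono mult_mono)
    also have "I 0 (B 0) + I 0 (space M - B 0) = I 0 (B 0 \<union> (space M - B 0))"
      using B_sets[of 0] by (intro I_split[symmetric]) auto
    also have "B 0 \<union> (space M - B 0) = space M" by (auto simp: B_def)
    also have "I 0 (space M) = m 0"
      unfolding I_def m_eq by (intro nn_integral_cong) auto
    finally show ?case .
  next
    case (Suc k)
    then have k: "k < n" and IH: "c k * m k + s * I k (space M - B k) \<le> s * m k" by auto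
    define A where "A = B (Suc k) - B k"
    have sets: "B k \<in> sets M" "B (Suc k) \<in> sets M" "A \<in> sets M"
      using B_sets k by (auto simp: A_def)
    have exit_k: "ennreal (exp (h * u)) * emeasure M A \<le> I (Suc k) A"
      unfolding I_def
    proof (rule exit)
      show "u < W (Suc k) \<omega>" if "\<omega> \<in> A" for \<omega>
        using that unfolding A_def B_def le_Suc_eq by blast
    qed (rule sets)
    have "B k \<subseteq> B (Suc k)" unfolding B_def le_Suc_eq by blast
    then have BU: "B (Suc k) = B k \<union> A" by (auto simp: A_def)
    have c_Suc: "c (Suc k) = c k + ennreal (exp (h * u)) * emeasure M A"
      unfolding c_def BU using sets
      by (subst plus_emeasure[symmetric]) (auto simp: A_def distrib_left)
    \<comment> \<open>The paths in \<open>A\<close> first exceed \<open>u\<close> at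
      \<open>Suc k\<close>. Their share of \<open>c (Suc k)\<close> is at most
      \<open>I (Suc k) A\<close>, and \<open>m (Suc k)\<close> is at most \<open>s\<close>, so they
      rejoin the survivors with weight \<open>s\<close>.\<close>
    have "c (Suc k) * m (Suc k) + s * I (Suc k) (space M - B (Suc k))
        \<le> c k * m (Suc k) + (I (Suc k) A * s + s * I (Suc k) (space M - B (Suc k)))"
      unfolding c_Suc distrib_right add.assoc using exit_k m_le[of "Suc k"] k
      by (intro add_mono mult_mono) auto
    also have "I (Suc k) A * s + s * I (Suc k) (space M - B (Suc k))
        = s * (I (Suc k) (A \<union> (space M - B (Suc k))))"
      using sets k by (subst I_split) (auto simp: A_def distrib_left mult.commute)
    also have "A \<union> (space M - B (Suc k)) = space M - B k"
      using BU sets.sets_into_space[OF sets(2)] by (auto simp: A_def)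
    also have "I (Suc k) (space M - B k) = I k (space M - B k) * exp_moment M h (X k)"
      unfolding I_def by (rule safe_Suc[OF k])
    also have "c k * m (Suc k) + s * (I k (space M - B k) * exp_moment M h (X k))
        = (c k * m k + s * I k (space M - B k)) * exp_moment M h (X k)"
      by (simp add: m_Suc[OF k] distrib_right mult.assoc)
    also have "\<dots> \<le> s * m k * exp_moment M h (X k)"
      by (rule mult_right_mono[OF IH]) simp
    also have "\<dots> = s * m (Suc k)" by (simp add: m_Suc[OF k] mult.assoc)
    finally show ?case .
  qed
  \<comment> \<open>Dropping the survivors from \<open>main\<close> leaves
    \<open>m n * c n \<le> m n * s\<close>, where \<open>m n\<close> cancels, being neither zero nor
    infinite.\<close>
  have "m n \<noteq> 0"
    unfolding m_def by (rule exp_moment_pos) (auto intro: prob_space_axioms W_rv)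
  moreover have "m n \<noteq> top" using m_le[of n] False by (auto simp: top_unique)
  moreover have "m n * c n \<le> m n * s"
  proof -
    have "m n * c n \<le> c n * m n + s * I n (space M - B n)"
      by (simp add: mult.commute)
    also have "\<dots> \<le> s * m n" by (rule main) simp
    finally show ?thesis by (simp add: mult.commute)
  qed
  ultimately have "c n \<le> s" by (simp add: ennreal_mult_le_mult_iff)
  then have "ennreal (exp (- h * u)) * c n \<le> ennreal (exp (- h * u)) * s"
    by (rule mult_left_mono) simp
  moreover have "ennreal (exp (- h * u)) * c n = emeasure M (B n)"
    by (simp add: c_def mult.assoc[symmetric] ennreal_mult[symmetric] exp_add[symmetric])
  ultimately show ?thesis by (simp add: B_def W_def)
qed

text \<open>Time 0 is added to \<open>F\<close> and the times are sorted. The increments between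
  neighbours are independent, and their partial sums telescope to \<open>Y\<close> almost surely
  because \<open>Y 0\<close> vanishes there.\<close>

lemma (in prob_space) exp_maximal_inequality_finite:
  assumes Y: "\<And>t. 0 \<le> t \<Longrightarrow> Y t \<in> borel_measurable M"
    and Y0: "AE \<omega> in M. Y 0 \<omega> = 0"
    and incr: "indep_increments M Y"
    and h: "0 \<le> h"
    and F: "finite F" "F \<subseteq> {0..}"
    and s: "\<And>t. t \<in> insert 0 F \<Longrightarrow> exp_moment M h (Y t) \<le> s"
  shows "emeasure M {\<omega> \<in> space M. \<exists>t\<in>F. u < Y t \<omega>} \<le> ennreal (exp (- h * u)) * s"
proof -
  define xs where "xs = sorted_list_of_set (insert 0 F)"
  define n where "n = length xs - 1"
  define \<tau> where "\<tau> i = xs ! i" for i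
  have set_xs: "set xs = insert 0 F" and sorted: "sorted_wrt (<) xs"
    using F(1) strict_sorted_list_of_set[of "insert 0 F"] by (simp_all add: xs_def del: sorted_list_of_set_insert_remove)
  have "xs \<noteq> []" using set_xs by auto
  then have len: "length xs = Suc n" by (simp add: n_def)
  have \<tau>_in: "\<tau> k \<in> insert 0 F" if "k \<le> n" for k
    unfolding \<tau>_def set_xs[symmetric] using that len by (intro nth_mem) auto
  have \<tau>_less: "\<tau> i < \<tau> j" if "i < j" "j \<le> n" for i j
    unfolding \<tau>_def using that len by (intro sorted_wrt_nth_less[OF sorted]) auto
  have ex_\<tau>: "\<exists>k\<le>n. t = \<tau> k" if "t \<in> insert 0 F" for t
    using that len unfolding set_xs[symmetric] in_set_conv_nth \<tau>_def by (auto simp: less_Suc_eq_le)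
  have \<tau>_nonneg: "0 \<le> \<tau> k" if "k \<le> n" for k
    using \<tau>_in[OF that] F(2) by auto
  have \<tau>_0: "\<tau> 0 = 0"
  proof -
    obtain k where k: "k \<le> n" "0 = \<tau> k" using ex_\<tau>[of 0] by auto
    then show ?thesis using \<tau>_less[of 0 k] \<tau>_nonneg[of 0] by (cases "k = 0") auto
  qed
  define X where "X i \<omega> = Y (\<tau> (Suc i)) \<omega> - Y (\<tau> i) \<omega>" for i \<omega>
  have indep: "indep_vars (\<lambda>_. borel) X {..<n}"
    using incr \<tau>_less \<tau>_0 unfolding indep_increments_def X_def by auto
  have sum_X: "(\<Sum>i<k. X i \<omega>) = Y (\<tau> k) \<omega> - Y 0 \<omega>" for k \<omega>
    unfolding X_def using sum_lessThan_telescope[of "\<lambda>i. Y (\<tau> i) \<omega>" k] by (simp add: \<tau>_0)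
  have AE_sum: "AE \<omega> in M. \<forall>k. (\<Sum>i<k. X i \<omega>) = Y (\<tau> k) \<omega>"
    using Y0 by eventually_elim (simp add: sum_X)
  have rv: "Y (\<tau> k) \<in> borel_measurable M" if "k \<le> n" for k
    using Y \<tau>_nonneg that by auto
  have *: "{\<omega> \<in> space M. \<exists>k\<le>n. u < f k \<omega>} \<in> sets M"
    if "\<And>k. k \<le> n \<Longrightarrow> f k \<in> borel_measurable M" for f :: "nat \<Rightarrow> 'a \<Rightarrow> real"
  proof -
    have "{\<omega> \<in> space M. \<exists>k\<le>n. u < f k \<omega>} = (\<Union>k\<le>n. {\<omega> \<in> space M. u < f k \<omega>})" by auto
    also have "\<dots> \<in> sets M"
    proof (rule sets.finite_UN)
      fix k assume "k \<in> {..n}"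
      then have [measurable]: "f k \<in> borel_measurable M" using that by auto
      show "{\<omega> \<in> space M. u < f k \<omega>} \<in> sets M" by measurable
    qed simp
    finally show ?thesis .
  qed
  \<comment> \<open>Only an inclusion: the added time 0 need not belong to \<open>F\<close>.\<close>
  have "{\<omega> \<in> space M. \<exists>t\<in>F. u < Y t \<omega>} \<subseteq> {\<omega> \<in> space M. \<exists>k\<le>n. u < Y (\<tau> k) \<omega>}"
    using ex_\<tau> by auto
  then have "emeasure M {\<omega> \<in> space M. \<exists>t\<in>F. u < Y t \<omega>}
      \<le> emeasure M {\<omega> \<in> space M. \<exists>k\<le>n. u < Y (\<tau> k) \<omega>}"
    by (rule emeasure_mono) (use * rv in auto)
  also have "\<dots> = emeasure M {\<omega> \<in> space M. \<exists>k\<le>n. u < (\<Sum>i<k. X i \<omega>)}"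
  proof (rule emeasure_eq_AE)
    show "AE \<omega> in M. \<omega> \<in> {\<omega> \<in> space M. \<exists>k\<le>n. u < Y (\<tau> k) \<omega>} \<longleftrightarrow>
        \<omega> \<in> {\<omega> \<in> space M. \<exists>k\<le>n. u < (\<Sum>i<k. X i \<omega>)}"
      using AE_sum by eventually_elim simp
    show "{\<omega> \<in> space M. \<exists>k\<le>n. u < (\<Sum>i<k. X i \<omega>)} \<in> sets M"
      unfolding sum_X using Y[of 0] rv by (intro *) auto
  qed (use * rv in auto)
  also have "\<dots> \<le> ennreal (exp (- h * u)) * s"
  proof (rule exp_maximal_inequality_indep_sums[OF indep h])
    fix k assume k: "k \<le> n"
    have "exp_moment M h (\<lambda>\<omega>. \<Sum>i<k. X i \<omega>) = exp_moment M h (Y (\<tau> k))"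
      by (rule exp_moment_cong_AE) (use AE_sum in eventually_elim, simp)
    then show "exp_moment M h (\<lambda>\<omega>. \<Sum>i<k. X i \<omega>) \<le> s" using s[OF \<tau>_in[OF k]] by simp
  qed
  finally show ?thesis .
qed

text \<open>Initial segments of an enumeration of \<open>D\<close> give increasing events, so the
  finite bound passes to the limit by continuity from below.\<close>

lemma (in prob_space) exp_maximal_inequality_countable:
  assumes Y: "\<And>t. 0 \<le> t \<Longrightarrow> Y t \<in> borel_measurable M"
    and Y0: "AE \<omega> in M. Y 0 \<omega> = 0"
    and incr: "indep_increments M Y"
    and h: "0 \<le> h"
    and D: "countable D" "D \<subseteq> {0..}"
    and s: "\<And>t. t \<in> insert 0 D \<Longrightarrow> exp_moment M h (Y t) \<le> s"
  shows "Pr M (\<lambda>\<omega>. \<exists>t\<in>D. u < Y t \<omega>) \<le> ennreal (exp (- h * u)) * s"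
proof (cases "D = {}")
  case True
  then show ?thesis by (simp add: Pr_def)
next
  case False
  define F where "F n = from_nat_into D ` {..n}" for n :: nat
  define B where "B n = {\<omega> \<in> space M. \<exists>t\<in>F n. u < Y t \<omega>}" for n
  have F: "finite (F n)" "F n \<subseteq> D" for n
    using from_nat_into[OF False] by (auto simp: F_def)
  have F_D: "(\<Union>n. F n) = D"
  proof (intro equalityI subsetI)
    fix t assume "t \<in> D"
    then obtain n where "from_nat_into D n = t" using from_nat_into_surj[OF D(1)] by blast
    then show "t \<in> (\<Union>n. F n)" by (auto simp: F_def)
  qed (use F(2) in auto)
  have B_sets: "B n \<in> sets M" for n
  proof -
    have "B n = (\<Union>t\<in>F n. {\<omega> \<in> space M. u < Y t \<omega>})" by (auto simp: B_def)
    also have "\<dots> \<in> sets M"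
    proof (rule sets.finite_UN)
      fix t assume "t \<in> F n"
      then have [measurable]: "Y t \<in> borel_measurable M" using F(2)[of n] D(2) Y by auto
      show "{\<omega> \<in> space M. u < Y t \<omega>} \<in> sets M" by measurable
    qed (rule F)
    finally show ?thesis .
  qed
  have "incseq B"
  proof (rule incseq_SucI)
    have "F n \<subseteq> F (Suc n)" for n by (auto simp: F_def)
    then show "B n \<subseteq> B (Suc n)" for n by (auto simp: B_def)
  qed
  have UN: "(\<Union>n. B n) = {\<omega> \<in> space M. \<exists>t\<in>D. u < Y t \<omega>}"
    unfolding B_def F_D[symmetric] by auto
  have "Pr M (\<lambda>\<omega>. \<exists>t\<in>D. u < Y t \<omega>) = emeasure M (\<Union>n. B n)"
    unfolding Pr_def UN[symmetric] using B_sets by (subst outer_measure_of_eq) auto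
  also have "\<dots> = (SUP n. emeasure M (B n))"
    using B_sets \<open>incseq B\<close> by (intro SUP_emeasure_incseq[symmetric]) auto
  also have "\<dots> \<le> ennreal (exp (- h * u)) * s"
  proof (rule SUP_least)
    fix n
    show "emeasure M (B n) \<le> ennreal (exp (- h * u)) * s"
      unfolding B_def
    proof (rule exp_maximal_inequality_finite[OF Y Y0 incr h F(1)])
      show "F n \<subseteq> {0..}" using F(2)[of n] D(2) by (rule order_trans)
      show "exp_moment M h (Y t) \<le> s" if "t \<in> insert 0 (F n)" for t
        using that F(2)[of n] by (intro s) auto
    qed
  qed
  finally show ?thesis .
qed

text \<open>Separability is applied to the closed interval \<open>{..u}\<close>: if no time of the
  countable set in an open interval leads above \<open>u\<close>, then no time of that interval
  does.\<close>

lemma separable_process_obtain_countable: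
  assumes "separable_process M X"
  obtains D where "countable D" "D \<subseteq> {0..}"
    "\<forall>u. AE \<omega> in M. (\<exists>t\<ge>0. u < X t \<omega>) \<longrightarrow> (\<exists>t\<in>D. u < X t \<omega>)"
    "\<forall>u T. AE \<omega> in M. (\<exists>t\<in>{0..T}. u < X t \<omega>) \<longrightarrow> (\<exists>t\<in>insert T D \<inter> {0..T}. u < X t \<omega>)"
proof -
  obtain D where D: "countable D" "D \<subseteq> {0..}"
    and sep: "AE \<omega> in M. \<forall>J A. open J \<and> is_interval J \<and> closed A \<and> is_interval A \<longrightarrow>
           (\<forall>t\<in>J \<inter> D. X t \<omega> \<in> A) \<longrightarrow> (\<forall>t\<in>J \<inter> {0..}. X t \<omega> \<in> A)"
    using assms unfolding separable_process_def by auto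
  have sep': "AE \<omega> in M. (\<exists>t\<in>J \<inter> {0..}. u < X t \<omega>) \<longrightarrow> (\<exists>t\<in>J \<inter> D. u < X t \<omega>)"
    if "open J" "is_interval J" for J u
    using sep
  proof eventually_elim
    case (elim \<omega>)
    have "is_interval {..u}" by (rule is_interval_ic)
    with elim[rule_format, of J "{..u}"] that show ?case
      by (auto simp: not_le[symmetric] simp del: not_le)
  qed
  have all: "AE \<omega> in M. (\<exists>t\<ge>0. u < X t \<omega>) \<longrightarrow> (\<exists>t\<in>D. u < X t \<omega>)" for u
    using sep'[of UNIV u] by (simp add: is_interval_univ Bex_def)
  \<comment> \<open>The open interval \<open>{..<T}\<close> misses the endpoint, which is why
    \<open>T\<close> joins the countable set.\<close>
  have fin: "AE \<omega> in M. (\<exists>t\<in>{0..T}. u < X t \<omega>) \<longrightarrow> (\<exists>t\<in>insert T D \<inter> {0..T}. u < X t \<omega>)" for u T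
    using sep'[of "{..<T}" u, OF open_lessThan is_interval_io]
  proof eventually_elim
    case (elim \<omega>)
    show ?case
    proof
      assume "\<exists>t\<in>{0..T}. u < X t \<omega>"
      then obtain t where t: "0 \<le> t" "t \<le> T" "u < X t \<omega>" by auto
      show "\<exists>t\<in>insert T D \<inter> {0..T}. u < X t \<omega>"
      proof (cases "t = T")
        case True
        with t show ?thesis by auto
      next
        case False
        with t elim obtain t' where "t' \<in> {..<T} \<inter> D" "u < X t' \<omega>" by force
        then show ?thesis using D(2) by (intro bexI[of _ t']) auto
      qed
    qed
  qed
  show thesis using that D all fin by simp
qed

lemma (in prob_space) exp_maximal_inequality_separable:
  assumes Y: "\<And>t. 0 \<le> t \<Longrightarrow> Y t \<in> borel_measurable M"
    and Y0: "AE \<omega> in M. Y 0 \<omega> = 0"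
    and incr: "indep_increments M Y"
    and sep: "separable_process M Y"
    and h: "0 \<le> h"
  shows "0 \<le> T \<Longrightarrow> Pr M (\<lambda>\<omega>. (SUP t\<in>{0..T}. ereal (Y t \<omega>)) > ereal u)
      \<le> ennreal (exp (- h * u)) * (SUP t\<in>{0..T}. exp_moment M h (Y t))"
    and "Pr M (\<lambda>\<omega>. (SUP t\<in>{0..}. ereal (Y t \<omega>)) > ereal u)
      \<le> ennreal (exp (- h * u)) * (SUP t\<in>{0..}. exp_moment M h (Y t))"
proof -
  obtain D where D: "countable D" "D \<subseteq> {0..}"
    and all: "\<forall>u. AE \<omega> in M. (\<exists>t\<ge>0. u < Y t \<omega>) \<longrightarrow> (\<exists>t\<in>D. u < Y t \<omega>)"
    and fin: "\<forall>u T. AE \<omega> in M. (\<exists>t\<in>{0..T}. u < Y t \<omega>) \<longrightarrow> (\<exists>t\<in>insert T D \<inter> {0..T}. u < Y t \<omega>)"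
    by (rule separable_process_obtain_countable[OF sep])
  show "Pr M (\<lambda>\<omega>. (SUP t\<in>{0..T}. ereal (Y t \<omega>)) > ereal u)
      \<le> ennreal (exp (- h * u)) * (SUP t\<in>{0..T}. exp_moment M h (Y t))" if T: "0 \<le> T"
  proof -
    have "Pr M (\<lambda>\<omega>. (SUP t\<in>{0..T}. ereal (Y t \<omega>)) > ereal u)
        \<le> Pr M (\<lambda>\<omega>. \<exists>t\<in>insert T D \<inter> {0..T}. u < Y t \<omega>)"
      using fin[rule_format, of T u] by (intro Pr_mono_AE) (simp add: less_SUP_iff)
    also have "\<dots> \<le> ennreal (exp (- h * u)) * (SUP t\<in>{0..T}. exp_moment M h (Y t))"
      using D T by (intro exp_maximal_inequality_countable Y Y0 incr h) (auto intro!: SUP_upper)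
    finally show ?thesis .
  qed
  have "Pr M (\<lambda>\<omega>. (SUP t\<in>{0..}. ereal (Y t \<omega>)) > ereal u) \<le> Pr M (\<lambda>\<omega>. \<exists>t\<in>D. u < Y t \<omega>)"
    using all[rule_format, of u] by (intro Pr_mono_AE) (simp add: less_SUP_iff Bex_def)
  also have "\<dots> \<le> ennreal (exp (- h * u)) * (SUP t\<in>{0..}. exp_moment M h (Y t))"
    using D by (intro exp_maximal_inequality_countable Y Y0 incr h) (auto intro!: SUP_upper)
  finally show "Pr M (\<lambda>\<omega>. (SUP t\<in>{0..}. ereal (Y t \<omega>)) > ereal u)
      \<le> ennreal (exp (- h * u)) * (SUP t\<in>{0..}. exp_moment M h (Y t))" .
qed

section \<open>Extended exponential, degenerate Stieltjes integrals and shifted integrals\<close>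

lemma exp_ennreal_mono: "x \<le> y \<Longrightarrow> exp_ennreal x \<le> exp_ennreal y"
  by (auto simp: exp_ennreal_def top_unique less_top intro!: ennreal_leI enn2real_mono)

lemma exp_ennreal_add: "exp_ennreal (x + y) = exp_ennreal x * exp_ennreal y"
  by (auto simp: exp_ennreal_def enn2real_plus less_top exp_add ennreal_mult
      ennreal_mult_top ennreal_top_mult ennreal_eq_0_iff not_le)

text \<open>The division with the single tagged interval \<open>{a}\<close> is fine for every gauge
  and has sum 0. This yields \<open>Y 0 = 0\<close>.\<close>

lemma has_stieltjes_integral_singleton:
  assumes "has_stieltjes_integral f S a a I"
  shows "I = 0"
proof (rule ccontr)
  assume "I \<noteq> 0"
  then obtain \<gamma> where \<gamma>: "gauge \<gamma>" and *:
    "\<And>D. D tagged_division_of {a..a} \<Longrightarrow> \<gamma> fine D \<Longrightarrow>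
       \<bar>(\<Sum>(x, K)\<in>D. f x * (S (Sup K) - S (Inf K))) - I\<bar> < \<bar>I\<bar>"
    using assms unfolding has_stieltjes_integral_def by (meson zero_less_abs_iff)
  have "{(a, cbox a a)} tagged_division_of cbox a a"
    by (rule tagged_division_of_self) simp
  moreover have "\<gamma> fine {(a, cbox a a)}"
    using \<gamma> by (auto simp: fine_def gauge_def)
  ultimately show False
    using *[of "{(a, cbox a a)}"] by simp
qed

text \<open>Split the integral at \<open>l\<close>, translate the second piece back by
  \<open>l\<close>, and compare pointwise.\<close>

lemma nn_integral_shift_subadditive:
  fixes f :: "real \<Rightarrow> ennreal"
  assumes f: "f \<in> borel_measurable (restrict_space lborel {0..})"
    and shift: "\<And>x. 0 \<le> x \<Longrightarrow> f (x + l) \<le> f x" and l: "0 \<le> l"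
  shows "(\<integral>\<^sup>+x\<in>{0..t + l}. f x \<partial>lborel) \<le> (\<integral>\<^sup>+x\<in>{0..l}. f x \<partial>lborel) + (\<integral>\<^sup>+x\<in>{0..t}. f x \<partial>lborel)"
proof -
  \<comment> \<open>Measurability is given on the half-line only; cutting off by an indicator makes
    the integrand Borel on the whole line.\<close>
  have f': "(\<lambda>x. f x * indicator {0..} x) \<in> borel_measurable borel"
    using f by (subst (asm) borel_measurable_restrict_space_iff_ennreal) auto
  have meas: "(\<lambda>x. f x * indicator {a..b} x) \<in> borel_measurable borel" if "0 \<le> a" for a b
  proof -
    have "(\<lambda>x. f x * indicator {0..} x * indicator {a..b} x) \<in> borel_measurable borel"
      using f' by measurable
    also have "(\<lambda>x. f x * indicator {0..} x * indicator {a..b} x) = (\<lambda>x. f x * indicator {a..b} x)"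
      using that by (auto simp: indicator_def fun_eq_iff)
    finally show ?thesis .
  qed
  have "(\<integral>\<^sup>+x\<in>{0..t + l}. f x \<partial>lborel)
      \<le> (\<integral>\<^sup>+x. f x * indicator {0..l} x + f x * indicator {l..t + l} x \<partial>lborel)"
    by (intro nn_integral_mono) (auto simp: indicator_def)
  also have "\<dots> = (\<integral>\<^sup>+x\<in>{0..l}. f x \<partial>lborel) + (\<integral>\<^sup>+x\<in>{l..t + l}. f x \<partial>lborel)"
    using meas[of 0 l] meas[of l "t + l"] l by (intro nn_integral_add) auto
  also have "(\<integral>\<^sup>+x\<in>{l..t + l}. f x \<partial>lborel)
      = (\<integral>\<^sup>+x. f (l + 1 * x) * indicator {l..t + l} (l + 1 * x) \<partial>lborel)"
    using meas[of l "t + l"] l by (subst nn_integral_real_affine[where c = 1 and t = l]) auto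
  also have "\<dots> \<le> (\<integral>\<^sup>+x\<in>{0..t}. f x \<partial>lborel)"
    using shift by (intro nn_integral_mono) (auto simp: indicator_def add.commute)
  finally show ?thesis by (simp add: add_left_mono)
qed

lemma set_integral_shift_superadditive:
  fixes f :: "real \<Rightarrow> real"
  assumes int: "\<And>t. 0 \<le> t \<Longrightarrow> set_integrable lborel {0..t} f"
    and nonneg: "\<And>x. 0 \<le> x \<Longrightarrow> 0 \<le> f x"
    and shift: "\<And>x. 0 \<le> x \<Longrightarrow> f x \<le> f (x + l)" and l: "0 \<le> l" and t: "0 \<le> t"
  shows "(LBINT x:{0..l}. f x) + (LBINT x:{0..t}. f x) \<le> (LBINT x:{0..t + l}. f x)"
proof -
  define F where "F s x = indicator {0..s} x * f x" for s x
  have F: "integrable lborel (F s)" if "0 \<le> s" for s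
    using int[OF that] by (simp add: set_integrable_def F_def[abs_def])
  have F': "integrable lborel (\<lambda>x. F t (- l + 1 * x))"
    by (rule lborel_integrable_real_affine[OF F[OF t]]) simp
  have "(\<integral>x. F l x \<partial>lborel) + (\<integral>x. F t x \<partial>lborel)
      = (\<integral>x. F l x \<partial>lborel) + (\<integral>x. F t (- l + 1 * x) \<partial>lborel)"
    by (subst (2) lborel_integral_real_affine[where c = 1 and t = "- l"]) auto
  also have "\<dots> = (\<integral>x. F l x + F t (- l + 1 * x) \<partial>lborel)"
    using F[OF l] F' by (intro Bochner_Integration.integral_add[symmetric])
  also have "\<dots> \<le> (\<integral>x. F (t + l) x \<partial>lborel)"
  proof (rule integral_mono_AE)
    \<comment> \<open>At \<open>x = l\<close> the windows \<open>{0..l}\<close> and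
      \<open>{l..t + l}\<close> overlap, so the pointwise comparison can fail at that one
      point.\<close>
    show "AE x in lborel. F l x + F t (- l + 1 * x) \<le> F (t + l) x"
      using AE_lborel_singleton[of l]
    proof eventually_elim
      case (elim x)
      show ?case
        using elim nonneg[of x] shift[of "x - l"] l t by (auto simp: F_def indicator_def)
    qed
  qed (use F F' l t in auto)
  finally show ?thesis by (simp add: set_lebesgue_integral_def F_def)
qed

section \<open>Exponential moments up to the index\<close>

text \<open>With \<open>\<theta> = h / h'\<close>, convexity puts \<open>exp (h * x)\<close> below
  the chord of \<open>exp\<close> between 0 and \<open>h' * x\<close>; integrate the chord.\<close>

lemma (in prob_space) exp_moment_le_1:
  assumes X: "X \<in> borel_measurable M" and h: "0 \<le> h" "h \<le> h'" and le: "exp_moment M h' X \<le> 1"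
  shows "exp_moment M h X \<le> 1"
proof (cases "h' = 0")
  case True
  with h show ?thesis by simp
next
  case False
  define \<theta> where "\<theta> = h / h'"
  have \<theta>: "0 \<le> \<theta>" "\<theta> \<le> 1" "h = \<theta> * h'" using h False by (auto simp: \<theta>_def field_simps)
  have convex: "exp (h * x) \<le> \<theta> * exp (h' * x) + (1 - \<theta>)" for x
    using convex_onD[OF exp_convex, of \<theta> 0 "h' * x"] \<theta> by (simp add: mult.assoc)
  have "exp_moment M h X \<le> (\<integral>\<^sup>+\<omega>. ennreal \<theta> * ennreal (exp (h' * X \<omega>)) + ennreal (1 - \<theta>) \<partial>M)"
    unfolding exp_moment_def using \<theta> convex
    by (intro nn_integral_mono) (simp add: ennreal_mult[symmetric] ennreal_plus[symmetric] del: ennreal_plus)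
  also have "\<dots> = ennreal \<theta> * exp_moment M h' X + ennreal (1 - \<theta>)"
    unfolding exp_moment_def using X
    by (subst nn_integral_add) (auto simp: nn_integral_cmult emeasure_space_1)
  also have "\<dots> \<le> ennreal \<theta> * 1 + ennreal (1 - \<theta>)"
    using le by (intro add_right_mono mult_left_mono) auto
  also have "\<dots> = 1" using \<theta> by (simp add: ennreal_plus[symmetric] del: ennreal_plus)
  finally show ?thesis .
qed

lemma (in prob_space) exp_moment_le_1_of_le_L_index:
  assumes X: "X \<in> borel_measurable M" and h: "0 \<le> h" "ennreal h \<le> L_index M X"
  shows "exp_moment M h X \<le> 1"
proof -
  have less: "exp_moment M k X \<le> 1" if k: "0 \<le> k" "ennreal k < L_index M X" for k
  proof -
    obtain h' where "0 \<le> h'" "exp_moment M h' X \<le> 1" "ennreal k < ennreal h'"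
      using k(2) unfolding L_index_def less_SUP_iff by auto
    with k X show ?thesis by (intro exp_moment_le_1[of X k h']) (auto simp: ennreal_less_iff)
  qed
  show ?thesis
  proof (cases "h = 0")
    case True
    then show ?thesis by simp
  next
    case False
    \<comment> \<open>The \<open>k n\<close> increase to \<open>h\<close> but stay strictly below
      it, hence strictly below the index even when \<open>h\<close> equals it; Fatou's lemma then
      reaches \<open>h\<close>.\<close>
    define k where "k n = h * (1 - inverse (real (Suc n)))" for n
    have k: "0 \<le> k n" "k n < h" for n
      using h False by (auto simp: k_def field_simps)
    have k_le: "exp_moment M (k n) X \<le> 1" for n
      using k[of n] h by (intro less less_le_trans[OF _ h(2)]) (auto simp: ennreal_less_iff)
    have "k \<longlonglongrightarrow> h * (1 - 0)"
      unfolding k_def by (intro tendsto_intros LIMSEQ_inverse_real_of_nat)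
    then have "(\<lambda>n. ennreal (exp (k n * X \<omega>))) \<longlonglongrightarrow> ennreal (exp (h * X \<omega>))" for \<omega>
      by (intro tendsto_ennrealI tendsto_intros) simp
    then have "liminf (\<lambda>n. ennreal (exp (k n * X \<omega>))) = ennreal (exp (h * X \<omega>))" for \<omega>
      by (intro lim_imp_Liminf) auto
    then have "exp_moment M h X = (\<integral>\<^sup>+\<omega>. liminf (\<lambda>n. ennreal (exp (k n * X \<omega>))) \<partial>M)"
      by (simp add: exp_moment_def)
    also have "\<dots> \<le> liminf (\<lambda>n. exp_moment M (k n) X)"
      unfolding exp_moment_def using X by (intro nn_integral_liminf) measurable
    also have "\<dots> \<le> liminf (\<lambda>n. 1)"
      using k_le by (intro Liminf_mono) auto
    finally show ?thesis by (simp add: Liminf_const)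
  qed
qed

text \<open>Reduce \<open>t\<close> modulo \<open>l\<close>: removing \<open>n\<close> whole periods
  does not decrease \<open>m\<close> and lands in \<open>{0..l}\<close>.\<close>

lemma SUP_atLeast_0_eq_of_shift_le:
  fixes m :: "real \<Rightarrow> ennreal"
  assumes l: "0 < l" and shift: "\<And>t. 0 \<le> t \<Longrightarrow> m (t + l) \<le> m t"
  shows "(SUP t\<in>{0..}. m t) = (SUP t\<in>{0..l}. m t)"
proof (rule antisym)
  show "(SUP t\<in>{0..}. m t) \<le> (SUP t\<in>{0..l}. m t)"
  proof (rule SUP_least)
    fix t :: real assume "t \<in> {0..}"
    then have t: "0 \<le> t" by simp
    define n where "n = nat \<lfloor>t / l\<rfloor>"
    define s where "s = t - real n * l"
    have n: "real n = of_int \<lfloor>t / l\<rfloor>" using t l by (simp add: n_def)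
    have "real n \<le> t / l" "t / l < real n + 1" unfolding n by linarith+
    then have s: "0 \<le> s" "s \<le> l" using l by (auto simp: s_def field_simps)
    have "m (s + real k * l) \<le> m s" for k
    proof (induction k)
      case (Suc k)
      have "m (s + real k * l + l) \<le> m (s + real k * l)" using s l by (intro shift) auto
      with Suc show ?case by (simp add: algebra_simps)
    qed simp
    from this[of n] have "m t \<le> m s" by (simp add: s_def)
    also have "\<dots> \<le> (SUP t\<in>{0..l}. m t)" using s by (intro SUP_upper) auto
    finally show "m t \<le> (SUP t\<in>{0..l}. m t)" .
  qed
  show "(SUP t\<in>{0..l}. m t) \<le> (SUP t\<in>{0..}. m t)"
    by (rule SUP_subset_mono) auto
qed

section \<open>Moments of \<open>Y\<close> and ruin in the risk model\<close>

context risk_model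
begin

text \<open>For \<open>h \<le> L\<close> one has \<open>E exp (h Y(l)) \<le> 1\<close>, by convexity of \<open>exp\<close> below \<open>L\<close> and by Fatou's lemma
  at \<open>L\<close>. The shift hypotheses make the log-moment subadditive, so
  \<open>E exp (h Y(t + l)) \<le> E exp (h Y(l)) * E exp (h Y(t)) \<le> E exp (h Y(t))\<close> and the supremum over all times
  already equals the one over \<open>[0, l]\<close>. The maximal inequality is Doob's for the martingale
  \<open>exp (h Y(t)) / E exp (h Y(t))\<close>, first along finitely many times and then, by separability, for all times.
  Ruin forces \<open>Y(t) > u\<close> for some \<open>t > 0\<close>.\<close>

lemma Y_0: "AE \<omega> in M. Y 0 \<omega> = 0"
  using Y_integral by eventually_elim (auto intro: has_stieltjes_integral_singleton)

lemma exp_moment_Y_0: "exp_moment M h (Y 0) = 1"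
  using exp_moment_cong_AE[OF Y_0, of h] by (simp add: exp_moment_def emeasure_space_1)

text \<open>Since \<open>r\<close> is monotone with \<open>r 0 = 0\<close>, the discount factor is
  Borel on the half-line and at most 1, so a multiple of \<open>p'\<close> dominates.\<close>

lemma discounted_premium_integrable:
  assumes t: "0 \<le> t"
  shows "set_integrable lborel {0..t} (\<lambda>x. h * exp (- r x) * p' x)"
proof -
  have p': "integrable lborel (\<lambda>x. indicator {0..t} x * p' x)"
    using p_density[OF t] by (simp add: set_integrable_def)
  have "r \<in> borel_measurable (restrict_space borel {0..})"
    by (rule borel_measurable_mono_on_fnc[OF r_mono])
  then have "(\<lambda>x. exp (- r x)) \<in> borel_measurable (restrict_space borel {0..})"
    by measurable
  then have e: "(\<lambda>x. indicator {0..} x * exp (- r x)) \<in> borel_measurable borel"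
    by (subst (asm) borel_measurable_restrict_space_iff) auto
  have eq: "indicator {0..t} x * (h * exp (- r x) * p' x)
      = h * (indicator {0..} x * exp (- r x)) * (indicator {0..t} x * p' x)" for x
    by (auto simp: indicator_def)
  have "integrable lborel (\<lambda>x. indicator {0..t} x * (h * exp (- r x) * p' x))"
  proof (rule Bochner_Integration.integrable_bound)
    show "integrable lborel (\<lambda>x. h * (indicator {0..t} x * p' x))"
      using p' by simp
    show "(\<lambda>x. indicator {0..t} x * (h * exp (- r x) * p' x)) \<in> borel_measurable lborel"
      unfolding eq using e borel_measurable_integrable[OF p'] by measurable
    show "AE x in lborel. norm (indicator {0..t} x * (h * exp (- r x) * p' x))
        \<le> norm (h * (indicator {0..t} x * p' x))"
    proof (rule AE_I2)
      fix x
      show "norm (indicator {0..t} x * (h * exp (- r x) * p' x)) \<le> norm (h * (indicator {0..t} x * p' x))"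
      proof (cases "x \<in> {0..t}")
        case True
        then have "exp (- r x) \<le> 1"
          using mono_onD[OF r_mono, of 0 x] by (simp add: r_0)
        then have "exp (- r x) * \<bar>h * p' x\<bar> \<le> 1 * \<bar>h * p' x\<bar>"
          by (rule mult_right_mono) simp
        with True show ?thesis by (simp add: abs_mult ac_simps)
      qed simp
    qed
  qed
  then show ?thesis by (simp add: set_integrable_def)
qed

text \<open>In the moment formula the premium integral \<open>A\<close> is superadditive and enters
  with a minus sign, while the claim integral \<open>B\<close> is subadditive; exponentiating gives
  the product bound.\<close>

lemma exp_moment_Y_shift_le:
  assumes h: "0 \<le> h" and t: "0 \<le> t" and l: "0 < l"
    and claims: "\<And>t. 0 \<le> t \<Longrightarrow>
      ennreal (exp (r (t + l))) * (exp_moment M (h * exp (- r (t + l))) (Z (t + l)) - 1)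
        \<le> ennreal (exp (r t)) * (exp_moment M (h * exp (- r t)) (Z t) - 1)"
    and intensity: "\<And>t. 0 \<le> t \<Longrightarrow> exp (- r (t + l)) * \<Lambda>' (t + l) \<le> exp (- r t) * \<Lambda>' t"
    and premium: "\<And>t. 0 \<le> t \<Longrightarrow> exp (- r (t + l)) * p' (t + l) \<ge> exp (- r t) * p' t"
  shows "exp_moment M h (Y (t + l)) \<le> exp_moment M h (Y l) * exp_moment M h (Y t)"
\<comment> \<open>The moment formula is available for positive times only.\<close>
proof (cases "t = 0")
  case True
  then show ?thesis by (simp add: exp_moment_Y_0)
next
  case False
  with t have t: "0 < t" by simp
  define f where "f x = h * exp (- r x) * p' x" for x
  define \<phi> where "\<phi> x = (exp_moment M (h * exp (- r x)) (Z x) - 1) * ennreal (\<Lambda>' x)" for x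
  define A where "A s = (LBINT x:{0..s}. f x)" for s
  define B where "B s = (\<integral>\<^sup>+x\<in>{0..s}. \<phi> x \<partial>lborel)" for s
  have E: "exp_moment M h (Y s) = ennreal (exp (- A s)) * exp_ennreal (B s)" if "0 < s" for s
    using Y_exp_moment[OF h that] by (simp add: A_def B_def f_def \<phi>_def)
  have "A l + A t \<le> A (t + l)"
    unfolding A_def
  proof (rule set_integral_shift_superadditive)
    show "set_integrable lborel {0..s} f" if "0 \<le> s" for s
      unfolding f_def[abs_def] by (rule discounted_premium_integrable[OF that])
    show "f x \<le> f (x + l)" if "0 \<le> x" for x
      using mult_left_mono[OF premium[OF that] h] by (simp add: f_def mult.assoc)
    show "0 \<le> f x" if "0 \<le> x" for x
      using p'_nonneg[OF that] h by (simp add: f_def)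
  qed (use l t in auto)
  then have "exp (- A (t + l)) \<le> exp (- A l) * exp (- A t)"
    by (simp add: exp_add[symmetric])
  moreover have "B (t + l) \<le> B l + B t"
    unfolding B_def
  proof (rule nn_integral_shift_subadditive)
    show "\<phi> \<in> borel_measurable (restrict_space lborel {0..})"
      unfolding \<phi>_def[abs_def] by (rule intensity_measurable[OF h])
    show "\<phi> (x + l) \<le> \<phi> x" if x: "0 \<le> x" for x
    proof -
      \<comment> \<open>Inserting \<open>exp (r y) * exp (- r y)\<close> separates the two factors
        that the hypotheses on claims and on intensity control under the shift.\<close>
      have \<phi>_eq: "\<phi> y = ennreal (exp (r y)) * (exp_moment M (h * exp (- r y)) (Z y) - 1)
          * ennreal (exp (- r y) * \<Lambda>' y)" if "0 \<le> y" for y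
      proof -
        have "ennreal (exp (r y)) * ennreal (exp (- r y) * \<Lambda>' y) = ennreal (\<Lambda>' y)"
          using \<Lambda>'_nonneg[OF that]
          by (simp add: ennreal_mult[symmetric] mult.assoc[symmetric] exp_add[symmetric])
        from this[symmetric] show ?thesis unfolding \<phi>_def by (simp only: ac_simps)
      qed
      show ?thesis
        using x l claims[OF x] intensity[OF x]
        by (simp add: \<phi>_eq mult_mono ennreal_leI)
    qed
  qed (use l in auto)
  ultimately have "exp_moment M h (Y (t + l))
      \<le> ennreal (exp (- A l) * exp (- A t)) * exp_ennreal (B l + B t)"
    using t l by (subst E) (auto intro!: mult_mono ennreal_leI exp_ennreal_mono)
  also have "\<dots> = exp_moment M h (Y l) * exp_moment M h (Y t)"
    using t l by (simp add: E exp_ennreal_add ennreal_mult ac_simps)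
  finally show ?thesis .
qed

lemma AE_ruin_imp_Y_exceeds:
  assumes u: "0 < u"
  shows "AE \<omega> in M. \<forall>t\<ge>0. R u t \<omega> < 0 \<longrightarrow> u < Y t \<omega>"
  using R_0[OF u] R_ge[OF u]
proof eventually_elim
  case (elim \<omega>)
  show ?case
  proof (intro allI impI)
    fix t :: real assume t: "0 \<le> t" and neg: "R u t \<omega> < 0"
    \<comment> \<open>The lower bound for \<open>R\<close> holds for positive times; at time 0 the
      reserve is \<open>u\<close>, which is positive, so there is no ruin.\<close>
    with elim(1) u have "t \<noteq> 0" by auto
    with t elim(2) have "u - Y t \<omega> \<le> exp (- r t) * R u t \<omega>" by auto
    also have "\<dots> < 0" using neg by (simp add: mult_less_0_iff)
    finally show "u < Y t \<omega>" by simp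
  qed
qed

lemma ruin_prob_finite_le:
  assumes u: "0 < u"
  shows "ruin_prob_finite M R u T \<le> Pr M (\<lambda>\<omega>. (SUP t\<in>{0..T}. ereal (Y t \<omega>)) > ereal u)"
  unfolding ruin_prob_finite_def
  by (rule Pr_mono_AE, use AE_ruin_imp_Y_exceeds[OF u] in eventually_elim)
    (auto simp: INF_less_iff less_SUP_iff)

lemma ruin_prob_le:
  assumes u: "0 < u"
  shows "ruin_prob M R u \<le> Pr M (\<lambda>\<omega>. (SUP t\<in>{0..}. ereal (Y t \<omega>)) > ereal u)"
  unfolding ruin_prob_def
  by (rule Pr_mono_AE, use AE_ruin_imp_Y_exceeds[OF u] in eventually_elim)
    (auto simp: INF_less_iff less_SUP_iff)

end


theorem theorem3p1:
  fixes M :: "'a measure"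
    and N :: "real \<Rightarrow> 'a \<Rightarrow> nat" and \<Lambda> \<Lambda>' :: "real \<Rightarrow> real"
    and Z :: "real \<Rightarrow> 'a \<Rightarrow> real"
    and p p' :: "real \<Rightarrow> real" and q :: "real \<Rightarrow> 'a \<Rightarrow> real"
    and r :: "real \<Rightarrow> real"
    and \<alpha> \<beta> :: "real \<Rightarrow> real \<Rightarrow> real \<Rightarrow> 'a \<Rightarrow> real"
    and R :: "real \<Rightarrow> real \<Rightarrow> 'a \<Rightarrow> real"
    and Y :: "real \<Rightarrow> 'a \<Rightarrow> real"
    and l :: real
  assumes model: "risk_model M N \<Lambda> \<Lambda>' Z p p' q r \<alpha> \<beta> R Y"
    and l: "0 < l"
    and claims: "\<And>h t. \<lbrakk>0 \<le> h; ennreal h \<le> L_index M (Y l); 0 \<le> t\<rbrakk> \<Longrightarrow>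
      ennreal (exp (r (t + l))) * (exp_moment M (h * exp (- r (t + l))) (Z (t + l)) - 1)
        \<le> ennreal (exp (r t)) * (exp_moment M (h * exp (- r t)) (Z t) - 1)"
    and intensity: "\<And>t. 0 \<le> t \<Longrightarrow> exp (- r (t + l)) * \<Lambda>' (t + l) \<le> exp (- r t) * \<Lambda>' t"
    and premium: "\<And>t. 0 \<le> t \<Longrightarrow> exp (- r (t + l)) * p' (t + l) \<ge> exp (- r t) * p' t"
  shows
    "(\<forall>h\<ge>0. ennreal h \<le> L_index M (Y l) \<longrightarrow>
        (SUP t\<in>{0..}. exp_moment M h (Y t)) = (SUP t\<in>{0..l}. exp_moment M h (Y t)) \<and>
        (\<forall>u>0. \<forall>T\<ge>0.
          ruin_prob_finite M R u T \<le> Pr M (\<lambda>\<omega>. (SUP t\<in>{0..T}. ereal (Y t \<omega>)) > ereal u) \<and>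
          Pr M (\<lambda>\<omega>. (SUP t\<in>{0..T}. ereal (Y t \<omega>)) > ereal u)
            \<le> ennreal (exp (- h * u)) * (SUP t\<in>{0..T}. exp_moment M h (Y t)) \<and>
          ruin_prob M R u \<le> Pr M (\<lambda>\<omega>. (SUP t\<in>{0..}. ereal (Y t \<omega>)) > ereal u) \<and>
          Pr M (\<lambda>\<omega>. (SUP t\<in>{0..}. ereal (Y t \<omega>)) > ereal u)
            \<le> ennreal (exp (- h * u)) * (SUP t\<in>{0..l}. exp_moment M h (Y t)))) \<and>
     (\<forall>u>0.
        ruin_prob M R u
          \<le> (INF h\<in>{h. 0 \<le> h \<and> ennreal h \<le> L_index M (Y l)}.
                ennreal (exp (- h * u)) * (SUP t\<in>{0..l}. exp_moment M h (Y t))) \<and>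
        (L_index M (Y l) < \<infinity> \<longrightarrow>
          (INF h\<in>{h. 0 \<le> h \<and> ennreal h \<le> L_index M (Y l)}.
                ennreal (exp (- h * u)) * (SUP t\<in>{0..l}. exp_moment M h (Y t)))
            \<le> (SUP t\<in>{0..l}. exp_moment M (enn2real (L_index M (Y l))) (Y t))
               * ennreal (exp (- enn2real (L_index M (Y l)) * u))))"
proof -
  interpret risk_model M N \<Lambda> \<Lambda>' Z p p' q r \<alpha> \<beta> R Y by fact
  let ?m = "\<lambda>h t. exp_moment M h (Y t)"
  have sup_eq: "(SUP t\<in>{0..}. ?m h t) = (SUP t\<in>{0..l}. ?m h t)"
    if h: "0 \<le> h" "ennreal h \<le> L_index M (Y l)" for h
  proof (rule SUP_atLeast_0_eq_of_shift_le[OF l])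
    fix t :: real assume t: "0 \<le> t"
    have "?m h (t + l) \<le> ?m h l * ?m h t"
      by (rule exp_moment_Y_shift_le[OF h(1) t l claims[OF h] intensity premium])
    also have "\<dots> \<le> 1 * ?m h t"
      using l h by (intro mult_right_mono exp_moment_le_1_of_le_L_index Y_rv) auto
    finally show "?m h (t + l) \<le> ?m h t" by simp
  qed
  have bound: "Pr M (\<lambda>\<omega>. (SUP t\<in>{0..}. ereal (Y t \<omega>)) > ereal u)
      \<le> ennreal (exp (- h * u)) * (SUP t\<in>{0..l}. ?m h t)"
    if h: "0 \<le> h" "ennreal h \<le> L_index M (Y l)" for h u
    unfolding sup_eq[OF h, symmetric]
    by (rule exp_maximal_inequality_separable(2)
        [OF Y_rv Y_0 Y_indep_increments Y_separable h(1)])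
  have ruin: "ruin_prob M R u \<le> (INF h\<in>{h. 0 \<le> h \<and> ennreal h \<le> L_index M (Y l)}.
      ennreal (exp (- h * u)) * (SUP t\<in>{0..l}. ?m h t))" if "0 < u" for u
    by (rule INF_greatest, rule order_trans[OF ruin_prob_le[OF that] bound]) auto
  \<comment> \<open>When the index is finite, it is itself an admissible \<open>h\<close>, so its
    term bounds the infimum.\<close>
  have last: "(INF h\<in>{h. 0 \<le> h \<and> ennreal h \<le> L_index M (Y l)}.
        ennreal (exp (- h * u)) * (SUP t\<in>{0..l}. ?m h t))
      \<le> (SUP t\<in>{0..l}. ?m (enn2real (L_index M (Y l))) t)
        * ennreal (exp (- enn2real (L_index M (Y l)) * u))"
    if "L_index M (Y l) < \<infinity>" for u
    using that by (subst mult.commute, intro INF_lower) auto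
  show ?thesis
    by (intro conjI allI impI sup_eq bound ruin last ruin_prob_finite_le ruin_prob_le
        exp_maximal_inequality_separable(1)[OF Y_rv Y_0 Y_indep_increments Y_separable])
qed

end
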